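(* Let $G$ be a finite connected multigraph without loops on vertices $v_1,\ldots,v_n$, and let $(\mathbf{r},\mathbf{d})$ be an arithmetical structure on $G$ with $\mathbf{r}=(r_1,\ldots,r_n)$. Then \[ |\mathcal{K}(G;\mathbf{r})| = \sum_{\mathcal{T}} \prod_{i=1}^n r_i^{\deg_{\mathcal{T}}(v_i)-2}, \] where the sum ranges over all spanning trees $\mathcal{T}$ of $G$ (as subsets of the edge set of $G$) and $\deg_{\mathcal{T}}(v_i)$ is the degree of $v_i$ in $\mathcal{T}$.
   Context: The adjacency matrix $A$ of $G$ has entry $(i,j)$ equal to the number of edges between $v_i$ and $v_j$. An arithmetical structure on $G$ is a pair $(\mathbf{r},\mathbf{d})$ with $\mathbf{d}\in\mathbb{Z}_{\ge0}^n$ and $\mathbf{r}\in\mathbb{Z}_{>0}^n$ having entries with greatest common divisor $1$, such that $(\mathrm{diag}(\mathbf{d})-A)\mathbf{r}=\mathbf{0}$. Set $L(G,\mathbf{r})=\mathrm{diag}(\mathbf{d})-A$; it has rank $n-1$, and $\mathcal{K}(G;\mathbf{r})$ denotes the (finite) torsion subgroup of the cokernel $\mathbb{Z}^n/L(G,\mathbf{r})\mathbb{Z}^n$. *)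

theory Defs
  imports Complex_Main
begin

text \<open>A finite loopless multigraph on vertices 0,...,n-1 is given by its adjacency
matrix A (A i j = number of edges between vertex i and vertex j).
Vectors in Z^n are functions nat => int supported on {..<n}.\<close>

definition loopless_multigraph :: "nat \<Rightarrow> (nat \<Rightarrow> nat \<Rightarrow> nat) \<Rightarrow> bool" where
  "loopless_multigraph n A \<longleftrightarrow> (\<forall>i<n. \<forall>j<n. A i j = A j i) \<and> (\<forall>i<n. A i i = 0)"

text \<open>The edge set: the edges between i < j are labelled (i, j, k) with k < A i j.\<close>
definition edges :: "nat \<Rightarrow> (nat \<Rightarrow> nat \<Rightarrow> nat) \<Rightarrow> (nat \<times> nat \<times> nat) set" where
  "edges n A = {(i, j, k). i < j \<and> j < n \<and> k < A i j}"

text \<open>Adjacency relation induced by a set of edges.\<close>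
definition edge_rel :: "(nat \<times> nat \<times> nat) set \<Rightarrow> (nat \<times> nat) set" where
  "edge_rel T = {(i, j). \<exists>k. (i, j, k) \<in> T \<or> (j, i, k) \<in> T}"

text \<open>The subgraph with vertex set {..<n} and edge set T is connected.\<close>
definition connected_on :: "nat \<Rightarrow> (nat \<times> nat \<times> nat) set \<Rightarrow> bool" where
  "connected_on n T \<longleftrightarrow> (\<forall>i<n. \<forall>j<n. (i, j) \<in> (edge_rel T)\<^sup>*)"

text \<open>Spanning tree (as a set of edges of G): spans all vertices, is connected, and is
minimally connected (removing any edge disconnects it), i.e. connected and acyclic.\<close>
definition spanning_tree :: "nat \<Rightarrow> (nat \<Rightarrow> nat \<Rightarrow> nat) \<Rightarrow> (nat \<times> nat \<times> nat) set \<Rightarrow> bool" where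
  "spanning_tree n A T \<longleftrightarrow> T \<subseteq> edges n A \<and> connected_on n T \<and>
     (\<forall>e\<in>T. \<not> connected_on n (T - {e}))"

definition spanning_trees :: "nat \<Rightarrow> (nat \<Rightarrow> nat \<Rightarrow> nat) \<Rightarrow> (nat \<times> nat \<times> nat) set set" where
  "spanning_trees n A = {T. spanning_tree n A T}"

definition tree_deg :: "(nat \<times> nat \<times> nat) set \<Rightarrow> nat \<Rightarrow> nat" where
  "tree_deg T v = card {e \<in> T. fst e = v \<or> fst (snd e) = v}"

definition arith_structure ::
  "nat \<Rightarrow> (nat \<Rightarrow> nat \<Rightarrow> nat) \<Rightarrow> (nat \<Rightarrow> int) \<Rightarrow> (nat \<Rightarrow> int) \<Rightarrow> bool" where
  "arith_structure n A r d \<longleftrightarrow>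
     (\<forall>i<n. d i \<ge> 0) \<and> (\<forall>i<n. r i > 0) \<and> Gcd (r ` {..<n}) = 1 \<and>
     (\<forall>i<n. d i * r i - (\<Sum>j<n. int (A i j) * r j) = 0)"

text \<open>The matrix L(G,r) = diag(d) - A.\<close>
definition Lmat :: "(nat \<Rightarrow> nat \<Rightarrow> nat) \<Rightarrow> (nat \<Rightarrow> int) \<Rightarrow> nat \<Rightarrow> nat \<Rightarrow> int" where
  "Lmat A d i j = (if i = j then d i else 0) - int (A i j)"

definition zvecs :: "nat \<Rightarrow> (nat \<Rightarrow> int) set" where
  "zvecs n = {x. \<forall>i\<ge>n. x i = 0}"

text \<open>The image lattice L Z^n.\<close>
definition image_lattice :: "nat \<Rightarrow> (nat \<Rightarrow> nat \<Rightarrow> int) \<Rightarrow> (nat \<Rightarrow> int) set" where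
  "image_lattice n L = {(\<lambda>i. if i < n then (\<Sum>j<n. L i j * y j) else 0) | y. y \<in> zvecs n}"

text \<open>Torsion subgroup of the cokernel Z^n / L Z^n: classes of vectors x with m x in L Z^n
for some positive integer m, modulo L Z^n.\<close>
definition torsion_coker :: "nat \<Rightarrow> (nat \<Rightarrow> nat \<Rightarrow> int) \<Rightarrow> (nat \<Rightarrow> int) set set" where
  "torsion_coker n L =
     {x \<in> zvecs n. \<exists>m::int. m > 0 \<and> (\<lambda>i. m * x i) \<in> image_lattice n L}
       // {(x, y). x \<in> zvecs n \<and> y \<in> zvecs n \<and> (\<lambda>i. x i - y i) \<in> image_lattice n L}"

text \<open>|K(G; r)|\<close>
definition crit_group_order :: "nat \<Rightarrow> (nat \<Rightarrow> nat \<Rightarrow> nat) \<Rightarrow> (nat \<Rightarrow> int) \<Rightarrow> nat" where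
  "crit_group_order n A d = card (torsion_coker n (Lmat A d))"

end

theory Submission
  imports Defs "HOL-Library.FuncSet" "Jordan_Normal_Form.Column_Operations"
    "Jordan_Normal_Form.Determinant"
begin

text \<open>
  Since the entries of r have greatest common divisor 1, there is an integer vector u with r.u = 1.
  Put M = L + u u^T. Then M r = u, hence M Z^n = L Z^n + Z u. As Z^n is the direct sum of
  Z u and the orthogonal lattice of r, which is the saturation of L Z^n, the torsion group has
  order [Z^n : M Z^n] = det M.

  Let P be diag(r) with row 0 replaced by r. Up to a unitriangular factor, P M P^T is the
  Laplacian with edge weights r_i r_j, reduced at vertex 0, so (prod r)^2 det M is the weighted
  number of spanning trees. The matrix-tree theorem is proved by expanding the determinant along
  all rows: a term is a choice of one incident edge for every vertex other than 0, and it
  contributes its weight if the choice leads every vertex to 0 and nothing otherwise. The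
  choices leading to 0 correspond to the spanning trees.
\<close>

section \<open>Determinants of matrices given by functions\<close>

text \<open>Keeping entries as a function lets row choices, index shifts and matrix products be
  written as lambda terms; the library type appears only where a determinant is taken.\<close>

definition sqmat :: "nat \<Rightarrow> (nat \<Rightarrow> nat \<Rightarrow> 'a) \<Rightarrow> 'a mat" where
  "sqmat n M = mat n n (\<lambda>(i, j). M i j)"

lemma sqmat_carrier [simp]: "sqmat n M \<in> carrier_mat n n"
  by (simp add: sqmat_def)

lemma sqmat_dim [simp]: "dim_row (sqmat n M) = n" "dim_col (sqmat n M) = n"
  by (simp_all add: sqmat_def)

lemma sqmat_index [simp]: "i < n \<Longrightarrow> j < n \<Longrightarrow> sqmat n M $$ (i, j) = M i j"
  by (simp add: sqmat_def)

lemma det_sqmat: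
  "det (sqmat n M) = (\<Sum>p | p permutes {..<n}. signof p * (\<Prod>i<n. M i (p i)))"
proof -
  have "(\<Prod>i = 0..<n. sqmat n M $$ (i, p i)) = (\<Prod>i<n. M i (p i))" if "p permutes {..<n}" for p
    unfolding atLeast0LessThan
  proof (rule prod.cong)
    fix i assume "i \<in> {..<n}"
    moreover from this have "p i < n" using permutes_in_image[OF that] by blast
    ultimately show "sqmat n M $$ (i, p i) = M i (p i)" by simp
  qed simp
  then show ?thesis
    by (subst det_def'[of _ n]) (auto simp: atLeast0LessThan intro!: sum.cong)
qed

lemma det_sqmat_scale_rows:
  "det (sqmat n (\<lambda>i j. c i * M i j)) = (\<Prod>i<n. c i) * det (sqmat n M)"
  by (simp add: det_sqmat prod.distrib sum_distrib_left mult_ac)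

text \<open>Multilinearity in all rows at once: in each Leibniz term the product over rows
  distributes over the sums, giving one term per choice function \<open>F\<close>, and exchanging
  the sums over \<open>F\<close> and over permutations reassembles determinants.\<close>

lemma det_sqmat_sum_rows:
  assumes "\<And>i. i < n \<Longrightarrow> finite (S i)"
  shows "det (sqmat n (\<lambda>i j. \<Sum>s\<in>S i. a i s j)) =
    (\<Sum>F\<in>PiE {..<n} S. det (sqmat n (\<lambda>i j. a i (F i) j)))"
proof -
  have "(\<Prod>i<n. \<Sum>s\<in>S i. a i s (p i)) = (\<Sum>F\<in>PiE {..<n} S. \<Prod>i<n. a i (F i) (p i))" for p
    by (rule prod_sum_PiE) (use assms in auto)
  then have "det (sqmat n (\<lambda>i j. \<Sum>s\<in>S i. a i s j)) =
      (\<Sum>p | p permutes {..<n}. \<Sum>F\<in>PiE {..<n} S. signof p * (\<Prod>i<n. a i (F i) (p i)))"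
    unfolding det_sqmat by (simp add: sum_distrib_left)
  also have "\<dots> = (\<Sum>F\<in>PiE {..<n} S. det (sqmat n (\<lambda>i j. a i (F i) j)))"
    unfolding det_sqmat by (rule sum.swap)
  finally show ?thesis .
qed

section \<open>Products, transposes and triangular matrices\<close>

lemma sqmat_mult:
  "sqmat n X * sqmat n Y = sqmat n (\<lambda>i j. \<Sum>k<n. X i k * Y k j)"
  by (intro eq_matI) (auto simp: scalar_prod_def atLeast0LessThan intro!: sum.cong)

lemma det_sqmat_mult:
  fixes X Y :: "nat \<Rightarrow> nat \<Rightarrow> 'a::comm_ring_1"
  shows "det (sqmat n (\<lambda>i j. \<Sum>k<n. X i k * Y k j)) = det (sqmat n X) * det (sqmat n Y)"
  unfolding sqmat_mult[symmetric] by (rule det_mult) auto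

lemma det_sqmat_transpose:
  fixes X :: "nat \<Rightarrow> nat \<Rightarrow> 'a::comm_ring_1"
  shows "det (sqmat n (\<lambda>i j. X j i)) = det (sqmat n X)"
proof -
  have "sqmat n (\<lambda>i j. X j i) = transpose_mat (sqmat n X)"
    by (intro eq_matI) auto
  then show ?thesis by (simp add: det_transpose[of _ n])
qed

lemma det_sqmat_upper_triangular:
  fixes X :: "nat \<Rightarrow> nat \<Rightarrow> 'a::comm_ring_1"
  assumes "\<And>i j. j < i \<Longrightarrow> i < n \<Longrightarrow> X i j = 0"
  shows "det (sqmat n X) = (\<Prod>i<n. X i i)"
proof -
  have "det (sqmat n X) = prod_list (diag_mat (sqmat n X))"
    by (rule det_upper_triangular[of _ n]) (use assms in auto)
  also have "\<dots> = (\<Prod>i<n. X i i)"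
    unfolding prod_list_diag_prod by (auto simp: atLeast0LessThan intro!: prod.cong)
  finally show ?thesis .
qed

section \<open>The index of a full-rank lattice\<close>

text \<open>The column lattice of \<open>M\<close>, without the support conditions of
  \<open>image_lattice\<close>: only the coordinates of \<open>x\<close> below \<open>n\<close> are
  tested and \<open>y\<close> is unrestricted.\<close>

definition in_lattice :: "nat \<Rightarrow> (nat \<Rightarrow> nat \<Rightarrow> int) \<Rightarrow> (nat \<Rightarrow> int) \<Rightarrow> bool" where
  "in_lattice n M x \<longleftrightarrow> (\<exists>y. \<forall>i<n. x i = (\<Sum>j<n. M i j * y j))"

section \<open>Closure properties of the column lattice\<close>

lemma in_lattice_cong:
  "(\<And>i. i < n \<Longrightarrow> x i = y i) \<Longrightarrow> in_lattice n M x \<longleftrightarrow> in_lattice n M y"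
  by (simp add: in_lattice_def)

lemma in_lattice_diff:
  assumes "in_lattice n M x" "in_lattice n M y"
  shows "in_lattice n M (\<lambda>i. x i - y i)"
proof -
  obtain a b where "\<forall>i<n. x i = (\<Sum>j<n. M i j * a j)" "\<forall>i<n. y i = (\<Sum>j<n. M i j * b j)"
    using assms unfolding in_lattice_def by blast
  then show ?thesis
    unfolding in_lattice_def
    by (intro exI[of _ "\<lambda>j. a j - b j"]) (simp add: right_diff_distrib sum_subtractf)
qed

lemma in_lattice_scale:
  assumes "in_lattice n M x"
  shows "in_lattice n M (\<lambda>i. c * x i)"
proof -
  obtain a where "\<forall>i<n. x i = (\<Sum>j<n. M i j * a j)"
    using assms unfolding in_lattice_def by blast
  then show ?thesis
    unfolding in_lattice_def
    by (intro exI[of _ "\<lambda>j. c * a j"]) (simp add: sum_distrib_left mult_ac)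
qed

lemma in_lattice_zero: "in_lattice n M (\<lambda>i. 0)"
  unfolding in_lattice_def by (intro exI[of _ "\<lambda>j. 0"]) simp

lemma in_lattice_add:
  assumes "in_lattice n M x" "in_lattice n M y"
  shows "in_lattice n M (\<lambda>i. x i + y i)"
  using in_lattice_diff[OF assms(1) in_lattice_scale[OF assms(2), of "-1"]] by simp

lemma image_lattice_iff:
  assumes "x \<in> zvecs n"
  shows "x \<in> image_lattice n M \<longleftrightarrow> in_lattice n M x"
proof
  assume "in_lattice n M x"
  then obtain y where y: "\<forall>i<n. x i = (\<Sum>j<n. M i j * y j)"
    unfolding in_lattice_def by blast
  let ?y = "\<lambda>j. if j < n then y j else 0"
  have "x = (\<lambda>i. if i < n then \<Sum>j<n. M i j * ?y j else 0)"
    using y assms by (auto simp: zvecs_def fun_eq_iff)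
  moreover have "?y \<in> zvecs n" by (simp add: zvecs_def)
  ultimately show "x \<in> image_lattice n M"
    unfolding image_lattice_def by (intro CollectI exI[of _ ?y] conjI)
qed (auto simp: image_lattice_def in_lattice_def)

text \<open>Cramer's rule: the adjugate applied to \<open>x\<close> is a preimage of
  \<open>det (sqmat n M)\<close> times \<open>x\<close>. This supplies one multiplier that works for
  all torsion classes.\<close>

lemma in_lattice_det_scale: "in_lattice n M (\<lambda>i. det (sqmat n M) * x i)"
proof -
  let ?M = "sqmat n M" and ?x = "vec n x"
  define y where "y = adj_mat ?M *\<^sub>v ?x"
  note adj = adj_mat[OF sqmat_carrier[of n M]]
  have y: "y \<in> carrier_vec n" unfolding y_def using adj(1) by (rule mult_mat_vec_carrier) simp
  have "?M *\<^sub>v y = (?M * adj_mat ?M) *\<^sub>v ?x"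
    unfolding y_def using adj(1) by (simp add: assoc_mult_mat_vec[of _ n n _ n])
  also have "\<dots> = det ?M \<cdot>\<^sub>v ?x"
  proof (intro eq_vecI)
    fix i assume "i < dim_vec (det ?M \<cdot>\<^sub>v ?x)"
    then have i: "i < n" by simp
    then have "((?M * adj_mat ?M) *\<^sub>v ?x) $ i = (\<Sum>j<n. (det ?M * (if j = i then 1 else 0)) * x j)"
      unfolding adj(2) by (auto simp: scalar_prod_def atLeast0LessThan intro!: sum.cong)
    also have "\<dots> = (\<Sum>j<n. if j = i then det ?M * x i else 0)"
      by (intro sum.cong) auto
    finally show "((?M * adj_mat ?M) *\<^sub>v ?x) $ i = (det ?M \<cdot>\<^sub>v ?x) $ i"
      using i by simp
  qed simp
  finally have eq: "?M *\<^sub>v y = det ?M \<cdot>\<^sub>v ?x" .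
  have "det ?M * x i = (\<Sum>j<n. M i j * y $ j)" if "i < n" for i
  proof -
    have "det ?M * x i = (?M *\<^sub>v y) $ i" using that unfolding eq by simp
    also have "\<dots> = (\<Sum>j<n. M i j * y $ j)"
      using that y by (simp add: scalar_prod_def atLeast0LessThan)
    finally show ?thesis .
  qed
  then show ?thesis unfolding in_lattice_def by blast
qed

text \<open>The index of the column lattice in Z^n, witnessed by a finite transversal
  \<open>S\<close> rather than by a quotient, so that transversals can be built coordinate by
  coordinate.\<close>

definition has_index :: "nat \<Rightarrow> (nat \<Rightarrow> nat \<Rightarrow> int) \<Rightarrow> nat \<Rightarrow> bool" where
  "has_index n M k \<longleftrightarrow> (\<exists>S\<subseteq>zvecs n. finite S \<and> card S = k \<and>
     (\<forall>x. \<exists>!s. s \<in> S \<and> in_lattice n M (\<lambda>i. x i - s i)))"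

section \<open>Column operations and splitting off the first coordinate\<close>

definition addcol_fun :: "int \<Rightarrow> nat \<Rightarrow> nat \<Rightarrow> (nat \<Rightarrow> nat \<Rightarrow> int) \<Rightarrow> nat \<Rightarrow> nat \<Rightarrow> int" where
  "addcol_fun a k l M = (\<lambda>i j. if j = k then a * M i l + M i j else M i j)"

text \<open>The added multiple of column \<open>l\<close> is absorbed by the invertible change of
  coefficients that adds \<open>a * y k\<close> to \<open>y l\<close>.\<close>

lemma in_lattice_addcol:
  assumes "k < n" "l < n" "k \<noteq> l"
  shows "in_lattice n (addcol_fun a k l M) x \<longleftrightarrow> in_lattice n M x"
proof -
  have 1: "(\<Sum>j<n. addcol_fun a k l M i j * y j) = (\<Sum>j<n. M i j * (y(l := y l + a * y k)) j)" for i y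
  proof -
    have "(\<Sum>j<n. addcol_fun a k l M i j * y j) =
        (\<Sum>j<n. M i j * y j + (if j = k then a * M i l * y k else 0))"
      by (intro sum.cong) (auto simp: addcol_fun_def algebra_simps)
    also have "\<dots> = (\<Sum>j<n. M i j * y j + (if j = l then a * M i l * y k else 0))"
      using assms by (simp add: sum.distrib)
    also have "\<dots> = (\<Sum>j<n. M i j * (y(l := y l + a * y k)) j)"
      by (intro sum.cong) (auto simp: algebra_simps)
    finally show ?thesis .
  qed
  show ?thesis
  proof
    show "in_lattice n (addcol_fun a k l M) x \<Longrightarrow> in_lattice n M x"
      unfolding in_lattice_def 1 by blast
  next
    assume "in_lattice n M x"
    then obtain y where y: "\<forall>i<n. x i = (\<Sum>j<n. M i j * y j)"
      unfolding in_lattice_def by blast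
    define z where "z = y(l := y l - a * y k)"
    have "z(l := z l + a * z k) = y"
      using assms by (auto simp: z_def)
    then show "in_lattice n (addcol_fun a k l M) x"
      unfolding in_lattice_def 1 using y by (intro exI[of _ z]) simp
  qed
qed

lemma det_addcol_fun:
  assumes "k < n" "l < n" "k \<noteq> l"
  shows "det (sqmat n (addcol_fun a k l M)) = det (sqmat n M)"
proof -
  have "sqmat n (addcol_fun a k l M) = addcol a k l (sqmat n M)"
    using assms by (intro eq_matI) (auto simp: addcol_fun_def)
  also have "\<dots> = sqmat n M * addrow_mat n a l k"
    by (rule addcol_mat) (use assms in auto)
  also have "det \<dots> = det (sqmat n M) * det (addrow_mat n a l k)"
    by (rule det_mult) auto
  also have "det (addrow_mat n a l k) = 1"
    by (rule det_addrow_mat) (use assms in auto)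
  finally show ?thesis by simp
qed

lemma det_sqmat_first_row:
  assumes "\<And>j. j < n \<Longrightarrow> M 0 (Suc j) = 0"
  shows "det (sqmat (Suc n) M) = M 0 0 * det (sqmat n (\<lambda>i j. M (Suc i) (Suc j)))"
proof -
  have "det (sqmat (Suc n) M) =
      (\<Sum>j<Suc n. sqmat (Suc n) M $$ (0, j) * cofactor (sqmat (Suc n) M) 0 j)"
    by (rule laplace_expansion_row) auto
  also have "\<dots> = M 0 0 * cofactor (sqmat (Suc n) M) 0 0"
    by (subst sum.lessThan_Suc_shift) (use assms in auto)
  also have "mat_delete (sqmat (Suc n) M) 0 0 = sqmat n (\<lambda>i j. M (Suc i) (Suc j))"
    by (intro eq_matI) (auto simp: mat_delete_def)
  then have "cofactor (sqmat (Suc n) M) 0 0 = det (sqmat n (\<lambda>i j. M (Suc i) (Suc j)))"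
    by (simp add: cofactor_def)
  finally show ?thesis .
qed

text \<open>Row 0 sees only the coefficient \<open>t\<close> of column 0. Once \<open>t\<close>
  times that column is subtracted, the other rows ask for membership in the lattice of the block
  without row 0 and column 0.\<close>

lemma in_lattice_first_row:
  assumes M0: "\<And>j. j < n \<Longrightarrow> M 0 (Suc j) = 0"
  shows "in_lattice (Suc n) M x \<longleftrightarrow>
    (\<exists>t. x 0 = M 0 0 * t \<and>
      in_lattice n (\<lambda>i j. M (Suc i) (Suc j)) (\<lambda>i. x (Suc i) - M (Suc i) 0 * t))"
proof
  assume "in_lattice (Suc n) M x"
  then obtain y where y: "\<And>i. i < Suc n \<Longrightarrow> x i = (\<Sum>j<Suc n. M i j * y j)"
    unfolding in_lattice_def by blast
  have "x 0 = M 0 0 * y 0"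
    using y[of 0] M0 by (simp add: sum.lessThan_Suc_shift del: sum.lessThan_Suc)
  moreover have "x (Suc i) - M (Suc i) 0 * y 0 = (\<Sum>j<n. M (Suc i) (Suc j) * y (Suc j))"
    if "i < n" for i
    using y[of "Suc i"] that by (simp add: sum.lessThan_Suc_shift del: sum.lessThan_Suc)
  ultimately show "\<exists>t. x 0 = M 0 0 * t \<and>
      in_lattice n (\<lambda>i j. M (Suc i) (Suc j)) (\<lambda>i. x (Suc i) - M (Suc i) 0 * t)"
    unfolding in_lattice_def by (intro exI[of _ "y 0"] conjI exI[of _ "\<lambda>j. y (Suc j)"]) auto
next
  assume "\<exists>t. x 0 = M 0 0 * t \<and>
      in_lattice n (\<lambda>i j. M (Suc i) (Suc j)) (\<lambda>i. x (Suc i) - M (Suc i) 0 * t)"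
  then obtain t y where t: "x 0 = M 0 0 * t"
    and y: "\<And>i. i < n \<Longrightarrow> x (Suc i) - M (Suc i) 0 * t = (\<Sum>j<n. M (Suc i) (Suc j) * y j)"
    unfolding in_lattice_def by blast
  have "x i = (\<Sum>j<Suc n. M i j * case_nat t y j)" if "i < Suc n" for i
  proof (cases i)
    case 0
    then show ?thesis using t M0 by (simp add: sum.lessThan_Suc_shift del: sum.lessThan_Suc)
  next
    case (Suc i')
    then show ?thesis
      using y[of i'] that by (simp add: sum.lessThan_Suc_shift algebra_simps del: sum.lessThan_Suc)
  qed
  then show "in_lattice (Suc n) M x"
    unfolding in_lattice_def by blast
qed

text \<open>A transversal consists of pairs: a residue modulo \<open>M 0 0\<close> for coordinate 0,
  which determines the coefficient of column 0, and a representative of what then remains in the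
  block.\<close>

lemma has_index_first_row:
  assumes M0: "\<And>j. j < n \<Longrightarrow> M 0 (Suc j) = 0" and g: "M 0 0 \<noteq> 0"
    and "has_index n (\<lambda>i j. M (Suc i) (Suc j)) k"
  shows "has_index (Suc n) M (nat \<bar>M 0 0\<bar> * k)"
proof -
  obtain S where S: "S \<subseteq> zvecs n" "finite S" "card S = k"
    "\<And>x. \<exists>!s. s \<in> S \<and> in_lattice n (\<lambda>i j. M (Suc i) (Suc j)) (\<lambda>i. x i - s i)"
    using assms(3) unfolding has_index_def by blast
  define f :: "int \<times> (nat \<Rightarrow> int) \<Rightarrow> nat \<Rightarrow> int" where "f = (\<lambda>(a, s). case_nat a s)"
  define S' where "S' = f ` ({0..<\<bar>M 0 0\<bar>} \<times> S)"
  have f0: "f p 0 = fst p" and fS: "f p (Suc i) = snd p i" for p i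
    by (auto simp: f_def split: prod.splits)
  have "inj f"
  proof (rule injI)
    fix p q assume "f p = f q"
    then have "fst p = fst q" "snd p = snd q"
      using f0 fS by (metis, metis ext)
    then show "p = q" by (simp add: prod_eq_iff)
  qed
  then have card: "card S' = nat \<bar>M 0 0\<bar> * k"
    unfolding S'_def by (subst card_image) (auto simp: inj_on_def S(3) card_cartesian_product)
  have lat: "in_lattice (Suc n) M z \<longleftrightarrow> (\<exists>t. z 0 = M 0 0 * t \<and>
      in_lattice n (\<lambda>i j. M (Suc i) (Suc j)) (\<lambda>i. z (Suc i) - M (Suc i) 0 * t))" for z
    by (rule in_lattice_first_row) (rule M0)
  have uniq: "\<exists>!s. s \<in> S' \<and> in_lattice (Suc n) M (\<lambda>i. x i - s i)" for x
  proof -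
    define a where "a = x 0 mod \<bar>M 0 0\<bar>"
    have a: "a \<in> {0..<\<bar>M 0 0\<bar>}" using g by (simp add: a_def)
    have "M 0 0 dvd x 0 - a"
      by (metis a_def abs_dvd_iff minus_mod_eq_mult_div dvd_triv_left)
    then obtain t where t: "x 0 - a = M 0 0 * t" by blast
    obtain s where s: "s \<in> S"
        "in_lattice n (\<lambda>i j. M (Suc i) (Suc j)) (\<lambda>i. (x (Suc i) - M (Suc i) 0 * t) - s i)"
      and suniq: "\<And>s'. s' \<in> S \<Longrightarrow>
        in_lattice n (\<lambda>i j. M (Suc i) (Suc j)) (\<lambda>i. (x (Suc i) - M (Suc i) 0 * t) - s' i) \<Longrightarrow> s' = s"
      using S(4)[of "\<lambda>i. x (Suc i) - M (Suc i) 0 * t"] by blast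
    have eqv: "x (Suc i) - s' i - M (Suc i) 0 * t = (x (Suc i) - M (Suc i) 0 * t) - s' i" for s' i
      by simp
    show ?thesis
    proof (rule ex1I[of _ "f (a, s)"], intro conjI)
      show "f (a, s) \<in> S'" using a s by (auto simp: S'_def)
      show "in_lattice (Suc n) M (\<lambda>i. x i - f (a, s) i)"
        unfolding lat using t s by (auto simp: f0 fS eqv intro!: exI[of _ t])
    next
      fix s' assume "s' \<in> S' \<and> in_lattice (Suc n) M (\<lambda>i. x i - s' i)"
      then obtain b q where s': "s' = f (b, q)" "b \<in> {0..<\<bar>M 0 0\<bar>}" "q \<in> S"
        and "in_lattice (Suc n) M (\<lambda>i. x i - s' i)"
        unfolding S'_def by auto
      then obtain t' where t': "x 0 - b = M 0 0 * t'"
        "in_lattice n (\<lambda>i j. M (Suc i) (Suc j)) (\<lambda>i. x (Suc i) - q i - M (Suc i) 0 * t')"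
        unfolding lat by (auto simp: f0 fS)
      \<comment> \<open>Moving the sign of \<open>M 0 0\<close> into the quotient turns this into
        division by its absolute value, where the remainder is unique.\<close>
      have "x 0 = \<bar>M 0 0\<bar> * (sgn (M 0 0) * t') + b"
        using t'(1) by (metis abs_mult_sgn add.commute diff_add_cancel mult.assoc)
      then have "b = a"
        using s'(2) unfolding a_def by simp
      with t t'(1) g have "t' = t" by auto
      with t'(2) have "in_lattice n (\<lambda>i j. M (Suc i) (Suc j)) (\<lambda>i. (x (Suc i) - M (Suc i) 0 * t) - q i)"
        by (simp add: eqv)
      then have "q = s" using suniq s'(3) by blast
      with \<open>b = a\<close> s' show "s' = f (a, s)" by simp
    qed
  qed
  have "S' \<subseteq> zvecs (Suc n)"
  proof
    fix z assume "z \<in> S'"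
    then obtain p where p: "z = f p" "snd p \<in> S" unfolding S'_def by auto
    have "f p i = 0" if "i \<ge> Suc n" for i
      using that p S(1) by (cases i) (auto simp: fS zvecs_def subset_iff)
    then show "z \<in> zvecs (Suc n)" by (simp add: p zvecs_def)
  qed
  then show ?thesis
    unfolding has_index_def using card uniq S(2) by (intro exI[of _ S']) (auto simp: S'_def)
qed

text \<open>Column additions change neither the lattice nor the determinant. The Euclidean algorithm
  on row 0 clears it outside column 0, after which both index and absolute determinant split off the
  factor \<open>\<bar>M 0 0\<bar>\<close>. The inner induction is on the sum of the absolute values
  in row 0.\<close>

theorem has_index_det:
  assumes "det (sqmat n M) \<noteq> 0"
  shows "has_index n M (nat \<bar>det (sqmat n M)\<bar>)"
  using assms
proof (induction n arbitrary: M)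
  case 0
  have "det (sqmat 0 M) = 1" by (rule det_dim_zero) simp
  moreover have "has_index 0 M 1"
    unfolding has_index_def by (intro exI[of _ "{\<lambda>i. 0}"]) (auto simp: zvecs_def in_lattice_def)
  ultimately show ?case by simp
next
  case (Suc n)
  have step: "has_index (Suc n) M (nat \<bar>det (sqmat (Suc n) M)\<bar>)"
    if "has_index (Suc n) (addcol_fun a k l M) (nat \<bar>det (sqmat (Suc n) (addcol_fun a k l M))\<bar>)"
      "k < Suc n" "l < Suc n" "k \<noteq> l" for a k l M
    using that by (simp add: has_index_def in_lattice_addcol det_addcol_fun)
  have base: "has_index (Suc n) M (nat \<bar>det (sqmat (Suc n) M)\<bar>)"
    if M0: "\<And>j. j < n \<Longrightarrow> M 0 (Suc j) = 0" and d: "det (sqmat (Suc n) M) \<noteq> 0" for M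
  proof -
    have "det (sqmat (Suc n) M) = M 0 0 * det (sqmat n (\<lambda>i j. M (Suc i) (Suc j)))"
      by (rule det_sqmat_first_row) (rule M0)
    with d show ?thesis
      using has_index_first_row[of n M, OF M0 _ Suc.IH] by (simp add: abs_mult nat_mult_distrib)
  qed
  show ?case
    using Suc.prems
  proof (induction "\<Sum>j<Suc n. nat \<bar>M 0 j\<bar>" arbitrary: M rule: less_induct)
    case less
    \<comment> \<open>Either one entry of row 0 can be reduced by another nonzero one, or everything
      outside a single column \<open>l > 0\<close> vanishes, or row 0 is already supported in column
      0.\<close>
    consider (two) k l where "k < Suc n" "l < Suc n" "k \<noteq> l" "M 0 l \<noteq> 0" "\<bar>M 0 l\<bar> \<le> \<bar>M 0 k\<bar>"
      | (one) l where "0 < l" "l < Suc n" "\<And>j. j < Suc n \<Longrightarrow> j \<noteq> l \<Longrightarrow> M 0 j = 0"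
      | (zero) "\<And>j. j < n \<Longrightarrow> M 0 (Suc j) = 0"
    proof (cases "\<exists>k l. k < Suc n \<and> l < Suc n \<and> k \<noteq> l \<and> M 0 l \<noteq> 0 \<and> M 0 k \<noteq> 0")
      case True
      then obtain k l where "k < Suc n" "l < Suc n" "k \<noteq> l" "M 0 l \<noteq> 0" "M 0 k \<noteq> 0" by blast
      then show ?thesis
        using two[of k l] two[of l k] by (cases "\<bar>M 0 l\<bar> \<le> \<bar>M 0 k\<bar>") auto
    next
      case False
      show ?thesis
      proof (cases "\<exists>l. 0 < l \<and> l < Suc n \<and> M 0 l \<noteq> 0")
        case True
        then obtain l where l: "0 < l" "l < Suc n" "M 0 l \<noteq> 0" by blast
        have "M 0 j = 0" if "j < Suc n" "j \<noteq> l" for j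
          using False l that by blast
        with l show ?thesis by (intro one[of l]) auto
      next
        case False
        with zero show ?thesis by auto
      qed
    qed
    then show ?case
    proof cases
      case two
      \<comment> \<open>With this sign the new entry in column \<open>k\<close> has absolute value
        \<open>\<bar>M 0 k\<bar> - \<bar>M 0 l\<bar>\<close>.\<close>
      define a where "a = - sgn (M 0 l) * sgn (M 0 k)"
      have "(\<Sum>j<Suc n. nat \<bar>addcol_fun a k l M 0 j\<bar>) < (\<Sum>j<Suc n. nat \<bar>M 0 j\<bar>)"
      proof (rule sum_strict_mono_ex1)
        have less: "\<bar>a * M 0 l + M 0 k\<bar> < \<bar>M 0 k\<bar>"
          using two(4,5) unfolding a_def by (auto simp: sgn_if abs_if split: if_splits)
        then show "\<forall>j\<in>{..<Suc n}. nat \<bar>addcol_fun a k l M 0 j\<bar> \<le> nat \<bar>M 0 j\<bar>"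
          by (auto simp: addcol_fun_def)
        show "\<exists>j\<in>{..<Suc n}. nat \<bar>addcol_fun a k l M 0 j\<bar> < nat \<bar>M 0 j\<bar>"
          using less two(1) by (intro bexI[of _ k]) (auto simp: addcol_fun_def)
      qed auto
      then have "has_index (Suc n) (addcol_fun a k l M)
          (nat \<bar>det (sqmat (Suc n) (addcol_fun a k l M))\<bar>)"
        by (rule less.hyps) (use two less.prems in \<open>simp add: det_addcol_fun\<close>)
      then show ?thesis by (rule step) (use two in auto)
    next
      case one
      \<comment> \<open>Two column additions move the only nonzero entry of row 0 to column 0.\<close>
      define M' where "M' = addcol_fun (-1) l 0 (addcol_fun 1 0 l M)"
      have "has_index (Suc n) M' (nat \<bar>det (sqmat (Suc n) M')\<bar>)"
      proof (rule base)
        show "M' 0 (Suc j) = 0" if "j < n" for j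
          using that one by (auto simp: M'_def addcol_fun_def)
        show "det (sqmat (Suc n) M') \<noteq> 0"
          using one less.prems by (simp add: M'_def det_addcol_fun)
      qed
      then have "has_index (Suc n) (addcol_fun 1 0 l M)
          (nat \<bar>det (sqmat (Suc n) (addcol_fun 1 0 l M))\<bar>)"
        unfolding M'_def by (rule step) (use one in auto)
      then show ?thesis by (rule step) (use one in auto)
    next
      case zero
      then show ?thesis using base less.prems by blast
    qed
  qed
qed

section \<open>Spanning trees as rooted choices of edges\<close>

definition incident :: "nat \<Rightarrow> nat \<times> nat \<times> nat \<Rightarrow> bool" where
  "incident i e \<longleftrightarrow> fst e = i \<or> fst (snd e) = i"

definition other_end :: "nat \<Rightarrow> nat \<times> nat \<times> nat \<Rightarrow> nat" where
  "other_end i e = (if fst e = i then fst (snd e) else fst e)"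

text \<open>The root 0 gets a dummy loop as its only choice, so that it is its own parent.\<close>
definition out_edges :: "(nat \<times> nat \<times> nat) set \<Rightarrow> nat \<Rightarrow> (nat \<times> nat \<times> nat) set" where
  "out_edges E i = (if i = 0 then {(0, 0, 0)} else {e \<in> E. incident i e})"

text \<open>Each vertex other than 0 points along its chosen edge to a parent; an edge may be chosen
  from both ends, and cycles may occur. The edge set is a parameter so that choices can be confined
  to a given subgraph.\<close>

definition orientations :: "nat \<Rightarrow> (nat \<times> nat \<times> nat) set \<Rightarrow> (nat \<Rightarrow> nat \<times> nat \<times> nat) set" where
  "orientations n E = PiE {..<n} (out_edges E)"

definition parent :: "(nat \<Rightarrow> nat \<times> nat \<times> nat) \<Rightarrow> nat \<Rightarrow> nat" where
  "parent F i = other_end i (F i)"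

definition rooted :: "nat \<Rightarrow> (nat \<Rightarrow> nat \<times> nat \<times> nat) \<Rightarrow> bool" where
  "rooted n F \<longleftrightarrow> (\<forall>i<n. \<exists>k. (parent F ^^ k) i = 0)"

section \<open>Ends of edges and parents\<close>

lemma other_end_less: "e \<in> edges n A \<Longrightarrow> other_end i e < n"
  by (auto simp: edges_def other_end_def)

lemma other_end_neq: "e \<in> edges n A \<Longrightarrow> other_end i e \<noteq> i"
  by (auto simp: edges_def other_end_def)

lemma other_end_eq: "incident i e \<Longrightarrow> incident j e \<Longrightarrow> i \<noteq> j \<Longrightarrow> other_end i e = j"
  by (auto simp: incident_def other_end_def)

lemma finite_edges [simp]: "finite (edges n A)"
proof -
  have "edges n A \<subseteq> (\<Union>i<n. \<Union>j<n. (\<lambda>k. (i, j, k)) ` {..<A i j})"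
    unfolding edges_def by force
  then show ?thesis by (rule finite_subset) auto
qed

lemma orientations_mem:
  "F \<in> orientations n E \<Longrightarrow> 0 < i \<Longrightarrow> i < n \<Longrightarrow> F i \<in> E \<and> incident i (F i)"
  unfolding orientations_def out_edges_def by (fastforce dest: PiE_mem)

lemma parent_less:
  "F \<in> orientations n (edges n A) \<Longrightarrow> i < n \<Longrightarrow> parent F i < n"
proof (cases "i = 0")
  case True
  assume "F \<in> orientations n (edges n A)" "i < n"
  then have "F 0 = (0, 0, 0)"
    using True unfolding orientations_def out_edges_def by (fastforce dest: PiE_mem)
  then show ?thesis using True \<open>i < n\<close> by (simp add: parent_def other_end_def)
next
  case False
  assume "F \<in> orientations n (edges n A)" "i < n"
  then show ?thesis
    using orientations_mem[of F n "edges n A" i] other_end_less False unfolding parent_def by blast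
qed

lemma orientations_mono: "E \<subseteq> E' \<Longrightarrow> orientations n E \<subseteq> orientations n E'"
  unfolding orientations_def out_edges_def by (intro PiE_mono) auto

text \<open>Induction on the number of parent steps to 0, which drops by one from a vertex to its
  parent. It serves as induction on depth in the tree.\<close>

lemma rooted_induct [consumes 3, case_names root step]:
  assumes F: "F \<in> orientations n (edges n A)" and "rooted n F" and "i < n"
    and "P 0" and step: "\<And>i. 0 < i \<Longrightarrow> i < n \<Longrightarrow> P (parent F i) \<Longrightarrow> P i"
  shows "P i"
proof -
  have "P i" if "(parent F ^^ k) i = 0" "i < n" for k i
    using that
  proof (induction k arbitrary: i)
    case 0
    then show ?case using \<open>P 0\<close> by simp
  next
    case (Suc k)
    then have "(parent F ^^ k) (parent F i) = 0"
      by (simp add: funpow_swap1)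
    then have "P (parent F i)"
      using Suc parent_less[OF F] by blast
    then show ?case using step \<open>P 0\<close> Suc.prems by (cases "i = 0") auto
  qed
  then show ?thesis using assms unfolding rooted_def by blast
qed

text \<open>Two vertices choosing the same edge are its two ends, hence each other's parents, and
  such a 2-cycle never reaches 0.\<close>

lemma inj_on_rooted:
  assumes F: "F \<in> orientations n (edges n A)" and R: "rooted n F"
  shows "inj_on F {1..<n}"
proof (rule inj_onI, rule ccontr)
  fix i j assume ij: "i \<in> {1..<n}" "j \<in> {1..<n}" "F i = F j" "i \<noteq> j"
  have "incident i (F i)" "incident j (F j)"
    using orientations_mem[OF F, of i] orientations_mem[OF F, of j] ij(1,2) by auto
  then have par: "parent F i = j" "parent F j = i"
    using ij other_end_eq unfolding parent_def by metis+
  have "x \<notin> {i, j}" if "x < n" for x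
    using F R that
  proof (induction rule: rooted_induct)
    case root
    then show ?case using ij by auto
  next
    case (step x)
    then show ?case using par by auto
  qed
  then show False using ij(1) by fastforce
qed

text \<open>If the choices at x differ, they also differ at the parent of x under F', and so on up to
  the root.\<close>
lemma rooted_eqI:
  assumes F: "F \<in> orientations n (edges n A)" "rooted n F"
    and F': "F' \<in> orientations n (edges n A)" "rooted n F'"
    and eq: "F ` {1..<n} = F' ` {1..<n}"
  shows "F = F'"
proof -
  have "\<not> (0 < i \<and> F i \<noteq> F' i)" if "i < n" for i
    using F' that
  proof (induction rule: rooted_induct)
    case root
    then show ?case by simp
  next
    case (step x)
    show ?case
    proof
      assume x: "0 < x \<and> F x \<noteq> F' x"
      \<comment> \<open>The edge that \<open>x\<close> chooses under \<open>F'\<close> is chosen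
        under \<open>F\<close> by its other end \<open>j\<close>. Injectivity of \<open>F'\<close>
        keeps \<open>j\<close> from choosing it under \<open>F'\<close>, so the two choices differ
        at \<open>j\<close> as well.\<close>
      have "F' x \<in> F ` {1..<n}" using step eq by auto
      then obtain j where j: "j \<in> {1..<n}" "F' x = F j" by auto
      with x have "j \<noteq> x" by metis
      have "incident x (F' x)" "incident j (F j)"
        using orientations_mem[OF F'(1) step(1,2)] orientations_mem[OF F(1), of j] j(1) by auto
      then have "parent F' x = j"
        using j \<open>j \<noteq> x\<close> other_end_eq unfolding parent_def by metis
      moreover have "F' j \<noteq> F' x"
        using inj_on_rooted[OF F'] j(1) step \<open>j \<noteq> x\<close> by (auto dest: inj_onD)
      ultimately show False using step j by auto
    qed
  qed
  moreover have "F 0 = F' 0" if "0 < n"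
    using F(1) F'(1) that unfolding orientations_def out_edges_def by (fastforce dest: PiE_mem)
  ultimately have "F i = F' i" if "i < n" for i
    using that by (cases "i = 0") auto
  then show ?thesis
    using F(1) F'(1) unfolding orientations_def by (intro PiE_ext) auto
qed

section \<open>Connected edge sets and rooted choices\<close>

lemma edge_rel_iff:
  "(i, j) \<in> edge_rel E \<longleftrightarrow> (\<exists>e\<in>E. incident i e \<and> other_end i e = j)"
proof
  assume "(i, j) \<in> edge_rel E"
  then obtain k where "(i, j, k) \<in> E \<or> (j, i, k) \<in> E" by (auto simp: edge_rel_def)
  then show "\<exists>e\<in>E. incident i e \<and> other_end i e = j"
    by (force simp: incident_def other_end_def)
qed (auto simp: edge_rel_def incident_def other_end_def split: if_splits)

lemma sym_edge_rel: "sym (edge_rel E)"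
  by (auto simp: sym_def edge_rel_def)

lemma connected_on_mono: "connected_on n E \<Longrightarrow> E \<subseteq> E' \<Longrightarrow> connected_on n E'"
proof -
  assume "connected_on n E" "E \<subseteq> E'"
  moreover have "(edge_rel E)\<^sup>* \<subseteq> (edge_rel E')\<^sup>*"
    by (rule rtrancl_mono) (use \<open>E \<subseteq> E'\<close> in \<open>auto simp: edge_rel_def\<close>)
  ultimately show ?thesis unfolding connected_on_def by blast
qed

text \<open>Parent paths join every vertex to 0 through chosen edges, and the relation is
  symmetric.\<close>

lemma connected_on_rooted:
  assumes F: "F \<in> orientations n (edges n A)" and R: "rooted n F"
  shows "connected_on n (F ` {1..<n})"
proof -
  let ?R = "(edge_rel (F ` {1..<n}))\<^sup>*"
  have to: "(i, 0) \<in> ?R" if "i < n" for i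
    using F R that
  proof (induction rule: rooted_induct)
    case (step x)
    have "(x, parent F x) \<in> edge_rel (F ` {1..<n})"
      using orientations_mem[OF F step(1,2)] step unfolding edge_rel_iff parent_def by force
    then show ?case using step by (meson converse_rtrancl_into_rtrancl)
  qed simp
  have "sym ?R" by (intro sym_rtrancl sym_edge_rel)
  then have "(0, i) \<in> ?R" if "i < n" for i
    using to[OF that] by (rule symD)
  with to show ?thesis unfolding connected_on_def by (meson rtrancl_trans)
qed

text \<open>As in a breadth-first search, every vertex other than 0 chooses an edge of
  \<open>E\<close> to a vertex strictly closer to 0, so following parents must end at 0.\<close>

lemma rooted_orientation_exists:
  assumes E: "E \<subseteq> edges n A" and con: "connected_on n E"
  obtains F where "F \<in> orientations n E" "rooted n F"
proof -
  define R where "R = edge_rel E"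
  define dist where "dist i = (LEAST k. (i, 0) \<in> R ^^ k)" for i
  have dist: "(i, 0) \<in> R ^^ dist i" if "i < n" for i
  proof -
    have "0 < n" using that by simp
    then have "(i, 0) \<in> R\<^sup>*" using con that unfolding connected_on_def R_def by blast
    then obtain k where "(i, 0) \<in> R ^^ k" by (auto dest: rtrancl_imp_relpow)
    then show ?thesis unfolding dist_def by (rule LeastI)
  qed
  have "\<exists>e. e \<in> E \<and> incident i e \<and> dist (other_end i e) < dist i" if i: "0 < i" "i < n" for i
  proof -
    have "dist i \<noteq> 0" using dist[OF i(2)] i(1) by (metis relpow_0_E less_numeral_extra(3))
    then obtain k where k: "dist i = Suc k" by (meson not0_implies_Suc)
    then obtain j where j: "(i, j) \<in> R" "(j, 0) \<in> R ^^ k"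
      using dist[OF i(2)] by (metis relpow_Suc_E2)
    have "dist j \<le> k" unfolding dist_def by (rule Least_le) (rule j)
    then show ?thesis using j(1) k unfolding R_def edge_rel_iff by (metis less_Suc_eq_le)
  qed
  then obtain G where G: "\<And>i. 0 < i \<Longrightarrow> i < n \<Longrightarrow>
      G i \<in> E \<and> incident i (G i) \<and> dist (other_end i (G i)) < dist i"
    by metis
  \<comment> \<open>The value at 0 is the dummy loop, and the restriction makes \<open>F\<close>
    extensional, as \<open>PiE\<close> demands.\<close>
  define F where "F = restrict (G(0 := (0, 0, 0))) {..<n}"
  have FG: "F i = G i" if "0 < i" "i < n" for i using that by (simp add: F_def)
  have F: "F \<in> orientations n E"
    unfolding orientations_def out_edges_def F_def using G by auto
  moreover have "rooted n F"
    unfolding rooted_def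
  proof (intro allI impI)
    fix i assume "i < n"
    then show "\<exists>k. (parent F ^^ k) i = 0"
    proof (induction "dist i" arbitrary: i rule: less_induct)
      case less
      show ?case
      proof (cases "i = 0")
        case True
        then show ?thesis by (intro exI[of _ 0]) simp
      next
        case False
        then have "dist (parent F i) < dist i"
          using G less FG by (simp add: parent_def)
        moreover have "parent F i < n"
          using parent_less F orientations_mono[OF E] less.prems by blast
        ultimately obtain k where "(parent F ^^ k) (parent F i) = 0"
          using less.hyps by blast
        then have "(parent F ^^ Suc k) i = 0" by (simp add: funpow_swap1)
        then show ?thesis by blast
      qed
    qed
  qed
  ultimately show ?thesis by (rule that)
qed

text \<open>A rooted choice inside \<open>E\<close> maps the vertices other than 0 injectively to
  edges.\<close>

lemma connected_on_card:
  assumes E: "E \<subseteq> edges n A" and con: "connected_on n E"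
  shows "n - 1 \<le> card E"
proof -
  obtain F where F: "F \<in> orientations n E" "rooted n F"
    using rooted_orientation_exists[OF E con] .
  then have "inj_on F {1..<n}"
    using inj_on_rooted orientations_mono[OF E] by blast
  moreover have "F ` {1..<n} \<subseteq> E" using orientations_mem[OF F(1)] by auto
  moreover have "finite E" using E finite_edges finite_subset by blast
  ultimately have "card {1..<n} \<le> card E" by (rule card_inj_on_le)
  then show ?thesis by simp
qed

text \<open>The image of a rooted choice is connected with \<open>n - 1\<close> edges, so deleting
  one leaves too few to stay connected. Conversely, a spanning tree contains the connected image of
  a rooted choice made within it, and minimality forces equality. Injectivity is
  \<open>rooted_eqI\<close>.\<close>

lemma bij_betw_rooted_spanning_trees:
  "bij_betw (\<lambda>F. F ` {1..<n}) {F \<in> orientations n (edges n A). rooted n F} (spanning_trees n A)"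
  (is "bij_betw ?im ?O _")
proof (rule bij_betw_imageI)
  show "inj_on ?im ?O"
    by (rule inj_onI) (use rooted_eqI in blast)
  have "?im F \<in> spanning_trees n A" if "F \<in> ?O" for F
  proof -
    have F: "F \<in> orientations n (edges n A)" "rooted n F" using that by auto
    have sub: "?im F \<subseteq> edges n A" using orientations_mem[OF F(1)] by auto
    have "\<not> connected_on n (?im F - {e})" if "e \<in> ?im F" for e
    proof
      assume "connected_on n (?im F - {e})"
      then have "n - 1 \<le> card (?im F - {e})"
        using connected_on_card[of "?im F - {e}" n A] sub by auto
      also have "\<dots> < card (?im F)"
        using that by (intro psubset_card_mono) auto
      also have "\<dots> = n - 1"
        using inj_on_rooted[OF F] by (simp add: card_image)
      finally show False by simp
    qed
    then show ?thesis
      using sub connected_on_rooted[OF F] unfolding spanning_trees_def spanning_tree_def by auto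
  qed
  moreover have "T \<in> ?im ` ?O" if "T \<in> spanning_trees n A" for T
  proof -
    have T: "T \<subseteq> edges n A" "connected_on n T" "\<And>e. e \<in> T \<Longrightarrow> \<not> connected_on n (T - {e})"
      using that unfolding spanning_trees_def spanning_tree_def by auto
    obtain F where F: "F \<in> orientations n T" "rooted n F"
      using rooted_orientation_exists[OF T(1,2)] .
    have F': "F \<in> orientations n (edges n A)" using F(1) orientations_mono[OF T(1)] by blast
    have sub: "?im F \<subseteq> T" using orientations_mem[OF F(1)] by auto
    have "?im F = T"
    proof (rule ccontr)
      assume "?im F \<noteq> T"
      with sub obtain e where "e \<in> T" "?im F \<subseteq> T - {e}" by blast
      then show False
        using connected_on_mono[OF connected_on_rooted[OF F' F(2)]] T(3) by blast
    qed
    then show ?thesis using F' F(2) by blast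
  qed
  ultimately show "?im ` ?O = spanning_trees n A" by blast
qed

text \<open>Double counting of incidences: the products over vertices and edges are exchanged, and
  every edge has two distinct ends.\<close>

lemma prod_edges_tree_deg:
  fixes r :: "nat \<Rightarrow> 'a::comm_monoid_mult"
  assumes "T \<subseteq> edges n A"
  shows "(\<Prod>e\<in>T. r (fst e) * r (fst (snd e))) = (\<Prod>i<n. r i ^ tree_deg T i)"
proof -
  have fin: "finite T" using assms finite_edges finite_subset by blast
  have "(\<Prod>i<n. r i ^ tree_deg T i) = (\<Prod>i<n. \<Prod>e\<in>T. if incident i e then r i else 1)"
    using fin by (simp add: tree_deg_def incident_def prod.If_cases Int_def)
  also have "\<dots> = (\<Prod>e\<in>T. \<Prod>i<n. if incident i e then r i else 1)"
    by (rule prod.swap)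
  also have "\<dots> = (\<Prod>e\<in>T. r (fst e) * r (fst (snd e)))"
  proof (rule prod.cong)
    fix e assume "e \<in> T"
    then have e: "fst e < n" "fst (snd e) < n" "fst e \<noteq> fst (snd e)"
      using assms by (auto simp: edges_def)
    have "(\<Prod>i<n. if incident i e then r i else 1) = (\<Prod>i\<in>{fst e, fst (snd e)}. r i)"
      using e by (intro prod.mono_neutral_cong_right) (auto simp: incident_def)
    then show "(\<Prod>i<n. if incident i e then r i else 1) = r (fst e) * r (fst (snd e))"
      using e by simp
  qed simp
  finally show ?thesis by simp
qed

section \<open>The weighted matrix-tree theorem\<close>

text \<open>For \<open>i\<close> and \<open>j\<close> other than 0 this is the reduced Laplacian of
  the functional graph \<open>i \<mapsto> f i\<close>. Row 0 and column 0 are padded instead of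
  deleted, which avoids shifting indices; the free vector \<open>b\<close> is later fitted to row 0
  of a congruence transform of \<open>M\<close>.\<close>

definition root_matrix :: "(nat \<Rightarrow> int) \<Rightarrow> (nat \<Rightarrow> nat) \<Rightarrow> nat \<Rightarrow> nat \<Rightarrow> int" where
  "root_matrix b f i j =
    (if i = 0 then if j = 0 then 1 else b j
     else if j = 0 then 0 else of_bool (j = i) - of_bool (j = f i))"

text \<open>In a nonzero Leibniz term each vertex other than 0 goes to itself or to its parent.
  Starting from the fixed root, the parent is already fixed, so injectivity fixes the vertex too;
  only the identity survives.\<close>

lemma det_root_matrix_rooted:
  assumes F: "F \<in> orientations n (edges n A)" and R: "rooted n F"
  shows "det (sqmat n (root_matrix b (parent F))) = 1"
proof -
  let ?M = "root_matrix b (parent F)"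
  have neq: "parent F i \<noteq> i" if "0 < i" "i < n" for i
    using orientations_mem[OF F that] other_end_neq unfolding parent_def by blast
  have zero: "(\<Prod>i<n. ?M i (p i)) = 0" if p: "p permutes {..<n}" and "p \<noteq> id" for p
  proof (rule ccontr)
    assume "(\<Prod>i<n. ?M i (p i)) \<noteq> 0"
    then have nz: "?M i (p i) \<noteq> 0" if "i < n" for i using that by auto
    have inj: "p i = p j \<Longrightarrow> i = j" for i j
      using permutes_inj[OF p] by (auto dest: injD)
    have "p i = i" if "i < n" for i
      using F R that
    proof (induction rule: rooted_induct)
      case root
      show ?case
      proof (cases "0 < n")
        case True
        \<comment> \<open>Column 0 is nonzero only in row 0, so the index sent to 0 must be
          0.\<close>
        then obtain j where j: "j < n" "p j = 0"
          using permutes_image[OF p] by (metis imageE lessThan_iff)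
        then have "j = 0" using nz[of j] by (auto simp: root_matrix_def split: if_splits)
        then show ?thesis using j by simp
      next
        case False
        then show ?thesis using p by simp
      qed
    next
      case (step i)
      show ?case
      proof (rule ccontr)
        assume "p i \<noteq> i"
        then have "p i = parent F i"
          using nz[OF step(2)] step(1) by (auto simp: root_matrix_def split: if_splits)
        then have "p i = p (parent F i)" using step by simp
        then show False using inj neq step by metis
      qed
    qed
    then have "p = id" using p by (metis eq_id_iff lessThan_iff permutes_not_in)
    with \<open>p \<noteq> id\<close> show False by simp
  qed
  have "det (sqmat n ?M) = (\<Sum>p\<in>{id}. signof p * (\<Prod>i<n. ?M i (p i)))"
    unfolding det_sqmat
    by (rule sum.mono_neutral_right) (use zero in \<open>auto simp: finite_permutations\<close>)
  moreover have "(\<Prod>i<n. ?M i (id i)) = 1"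
  proof (rule prod.neutral, safe)
    fix i assume "i < n"
    then show "?M i (id i) = 1" using neq[of i] by (cases "i = 0") (auto simp: root_matrix_def)
  qed
  ultimately show ?thesis by simp
qed

lemma det_root_matrix_unrooted:
  assumes F: "F \<in> orientations n (edges n A)" and R: "\<not> rooted n F"
  shows "det (sqmat n (root_matrix b (parent F))) = 0"
proof -
  let ?M = "root_matrix b (parent F)"
  define w :: "nat \<Rightarrow> int" where "w j = of_bool (\<nexists>k. (parent F ^^ k) j = 0)" for j
  \<comment> \<open>The vertices that do not lead to 0 give a kernel vector; its entry at 0 only repairs row 0.\<close>
  define v where "v j = (if j = 0 then - (\<Sum>j\<in>{1..<n}. b j * w j) else w j)" for j
  obtain i0 where i0: "i0 < n" "w i0 = 1" using R by (auto simp: rooted_def w_def)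
  have w0: "w 0 = 0" unfolding w_def by (auto intro: exI[of _ 0])
  with i0 have "i0 \<noteq> 0" by (cases "i0 = 0") auto
  \<comment> \<open>A vertex leads to 0 exactly if its parent does; hence row \<open>i\<close>
    applied to the vector, which is \<open>w i - w (parent F i)\<close>, vanishes.\<close>
  have w_parent: "w (parent F i) = w i" if "0 < i" for i
  proof -
    have "(\<exists>k. (parent F ^^ k) i = 0) \<longleftrightarrow> (\<exists>k. (parent F ^^ k) (parent F i) = 0)"
    proof
      assume "\<exists>k. (parent F ^^ k) i = 0"
      then obtain k where k: "(parent F ^^ k) i = 0" by blast
      with that obtain m where "k = Suc m" by (cases k) auto
      with k show "\<exists>k. (parent F ^^ k) (parent F i) = 0" by (auto simp: funpow_swap1)
    next
      assume "\<exists>k. (parent F ^^ k) (parent F i) = 0"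
      then obtain k where "(parent F ^^ Suc k) i = 0" by (auto simp: funpow_swap1)
      then show "\<exists>k. (parent F ^^ k) i = 0" by blast
    qed
    then show ?thesis by (simp add: w_def)
  qed
  have split: "{..<n} = insert 0 {1..<n}" using i0(1) by auto
  have "(\<Sum>j<n. ?M i j * v j) = 0" if i: "i < n" for i
  proof (cases "i = 0")
    case True
    have "(\<Sum>j\<in>{1..<n}. ?M 0 j * v j) = (\<Sum>j\<in>{1..<n}. b j * w j)"
      by (intro sum.cong) (auto simp: root_matrix_def v_def)
    then show ?thesis
      unfolding split True by (simp add: root_matrix_def v_def)
  next
    case False
    have "(\<Sum>j<n. ?M i j * v j) =
        (\<Sum>j<n. (if j = i then w i else 0) - (if j = parent F i then w (parent F i) else 0))"
      using False w0 by (intro sum.cong) (auto simp: root_matrix_def v_def)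
    also have "\<dots> = w i - w (parent F i)"
      using i parent_less[OF F i] by (simp add: sum_subtractf)
    finally show ?thesis using w_parent False by simp
  qed
  then have "sqmat n ?M *\<^sub>v vec n v = 0\<^sub>v n"
    by (intro eq_vecI) (auto simp: scalar_prod_def atLeast0LessThan)
  moreover have "vec n v \<noteq> 0\<^sub>v n"
  proof
    assume "vec n v = 0\<^sub>v n"
    then have "vec n v $ i0 = 0" using i0 by simp
    then show False using i0 \<open>i0 \<noteq> 0\<close> by (simp add: v_def)
  qed
  ultimately show ?thesis
    using det_0_iff_vec_prod_zero[OF sqmat_carrier] vec_carrier by blast
qed

section \<open>From labelled edges to entries of the adjacency matrix\<close>

lemma card_edges_between:
  assumes G: "loopless_multigraph n A" and "i < n" "k < n"
  shows "card {e \<in> edges n A. incident i e \<and> other_end i e = k} = A i k"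
proof -
  have eq: "A i k = A k i" "A i i = 0"
    using assms unfolding loopless_multigraph_def by auto
  consider "i < k" | "k < i" | "i = k" by linarith
  then show ?thesis
  proof cases
    case 1
    then have "{e \<in> edges n A. incident i e \<and> other_end i e = k} = (\<lambda>m. (i, k, m)) ` {..<A i k}"
      using assms by (auto simp: edges_def incident_def other_end_def)
    then show ?thesis by (simp add: card_image inj_on_def)
  next
    case 2
    then have "{e \<in> edges n A. incident i e \<and> other_end i e = k} = (\<lambda>m. (k, i, m)) ` {..<A k i}"
      using assms by (auto simp: edges_def incident_def other_end_def)
    then show ?thesis by (simp add: card_image inj_on_def eq)
  next
    case 3
    then have "{e \<in> edges n A. incident i e \<and> other_end i e = k} = {}"
      using other_end_neq by auto
    then show ?thesis using 3 eq by simp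
  qed
qed

lemma sum_incident_edges:
  fixes g :: "nat \<Rightarrow> int"
  assumes G: "loopless_multigraph n A" and i: "i < n"
  shows "(\<Sum>e | e \<in> edges n A \<and> incident i e. g (other_end i e)) = (\<Sum>k<n. int (A i k) * g k)"
proof -
  let ?I = "{e \<in> edges n A. incident i e}"
  have "(\<Sum>e\<in>?I. g (other_end i e)) =
      (\<Sum>k<n. \<Sum>e | e \<in> ?I \<and> other_end i e = k. g (other_end i e))"
    by (rule sum.group[symmetric]) (use other_end_less in auto)
  also have "\<dots> = (\<Sum>k<n. \<Sum>e\<in>{e \<in> edges n A. incident i e \<and> other_end i e = k}. g k)"
    by (intro sum.cong) auto
  also have "\<dots> = (\<Sum>k<n. int (A i k) * g k)"
    by (intro sum.cong) (use card_edges_between[OF G i] in auto)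
  finally show ?thesis by simp
qed

text \<open>Away from index 0 this is the Laplacian with weight \<open>r i * r j\<close> on the
  edges between \<open>i\<close> and \<open>j\<close>: by the structure equation, the diagonal entry
  \<open>r i * r i * d i\<close> is the total weight at \<open>i\<close>. The padding matches
  \<open>root_matrix\<close>.\<close>

definition reduced_laplacian ::
  "(nat \<Rightarrow> int) \<Rightarrow> (nat \<Rightarrow> nat \<Rightarrow> nat) \<Rightarrow> (nat \<Rightarrow> int) \<Rightarrow> (nat \<Rightarrow> int) \<Rightarrow> nat \<Rightarrow> nat \<Rightarrow> int" where
  "reduced_laplacian b A r d i j =
    (if i = 0 then if j = 0 then 1 else b j
     else if j = 0 then 0 else r i * r j * Lmat A d i j)"

text \<open>Each row is a weighted sum of rows of root matrices over the edges at that vertex.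
  Expanding all rows leaves one determinant per choice, equal to 1 for rooted choices and 0
  otherwise, and rooted choices correspond to spanning trees.\<close>

theorem weighted_matrix_tree:
  assumes G: "loopless_multigraph n A"
    and dr: "\<And>i. i < n \<Longrightarrow> d i * r i = (\<Sum>j<n. int (A i j) * r j)"
  shows "det (sqmat n (reduced_laplacian b A r d)) =
    (\<Sum>T\<in>spanning_trees n A. \<Prod>i<n. r i ^ tree_deg T i)"
proof -
  let ?E = "edges n A"
  define w where "w e = r (fst e) * r (fst (snd e))" for e :: "nat \<times> nat \<times> nat"
  \<comment> \<open>The dummy loop of the root carries weight 1, so only the edges chosen by the
    other vertices count.\<close>
  define c where "c i e = (if i = 0 then 1 else w e)" for i :: nat and e
  have w: "w e = r i * r (other_end i e)" if "incident i e" for i e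
    using that by (auto simp: w_def incident_def other_end_def)
  have row: "reduced_laplacian b A r d i j =
      (\<Sum>e\<in>out_edges ?E i. c i e * root_matrix b (\<lambda>i. other_end i e) i j)"
    if i: "i < n" and j: "j < n" for i j
  proof -
    consider "i = 0" | "0 < i" "j = 0" | "0 < i" "0 < j" by linarith
    then show ?thesis
    proof cases
      case 3
      have "(\<Sum>e\<in>out_edges ?E i. c i e * root_matrix b (\<lambda>i. other_end i e) i j) =
          (\<Sum>e | e \<in> ?E \<and> incident i e. (\<lambda>k. r i * r k * (of_bool (j = i) - of_bool (j = k))) (other_end i e))"
        using 3 by (intro sum.cong) (auto simp: out_edges_def c_def w root_matrix_def)
      also have "\<dots> = (\<Sum>k<n. int (A i k) * (r i * r k * (of_bool (j = i) - of_bool (j = k))))"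
        by (rule sum_incident_edges[OF G i])
      also have "\<dots> = (\<Sum>k<n. of_bool (j = i) * r i * (int (A i k) * r k) -
          (if k = j then r i * r j * int (A i j) else 0))"
        by (intro sum.cong) (auto simp: algebra_simps)
      \<comment> \<open>The structure equation evaluates the sum of \<open>A i k * r k\<close> to
        \<open>d i * r i\<close>.\<close>
      also have "\<dots> = of_bool (j = i) * r i * (d i * r i) - r i * r j * int (A i j)"
        using i j by (simp add: sum_subtractf sum_distrib_left[symmetric] dr)
      also have "\<dots> = reduced_laplacian b A r d i j"
        using 3 by (auto simp: reduced_laplacian_def Lmat_def algebra_simps)
      finally show ?thesis by simp
    qed (auto simp: reduced_laplacian_def out_edges_def c_def root_matrix_def)
  qed
  \<comment> \<open>Row \<open>i\<close> depends on the parent function only through its value at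
    \<open>i\<close>, so the edgewise rows assemble into one matrix for
    \<open>parent F\<close>.\<close>
  have par: "root_matrix b (\<lambda>i'. other_end i' (F i)) i j = root_matrix b (parent F) i j" for F i j
    by (simp add: root_matrix_def parent_def)
  have "det (sqmat n (reduced_laplacian b A r d)) =
      det (sqmat n (\<lambda>i j. \<Sum>e\<in>out_edges ?E i. c i e * root_matrix b (\<lambda>i. other_end i e) i j))"
    by (intro arg_cong[of _ _ det] eq_matI) (auto simp: row)
  also have "\<dots> = (\<Sum>F\<in>PiE {..<n} (out_edges ?E).
      det (sqmat n (\<lambda>i j. c i (F i) * root_matrix b (\<lambda>i'. other_end i' (F i)) i j)))"
    by (rule det_sqmat_sum_rows) (simp add: out_edges_def)
  also have "\<dots> = (\<Sum>F\<in>orientations n ?E.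
      (\<Prod>i<n. c i (F i)) * det (sqmat n (root_matrix b (parent F))))"
    unfolding orientations_def par det_sqmat_scale_rows ..
  also have "\<dots> = (\<Sum>F\<in>orientations n ?E. if rooted n F then \<Prod>i<n. c i (F i) else 0)"
    by (intro sum.cong) (auto simp: det_root_matrix_rooted det_root_matrix_unrooted)
  also have "\<dots> = (\<Sum>F | F \<in> orientations n ?E \<and> rooted n F. \<Prod>i<n. c i (F i))"
    by (rule sum.inter_filter[symmetric]) (auto simp: orientations_def out_edges_def intro!: finite_PiE)
  also have "\<dots> = (\<Sum>F | F \<in> orientations n ?E \<and> rooted n F. \<Prod>e\<in>F ` {1..<n}. w e)"
  proof (intro sum.cong refl)
    fix F assume "F \<in> {F \<in> orientations n ?E. rooted n F}"
    then have inj: "inj_on F {1..<n}" using inj_on_rooted by blast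
    have "(\<Prod>i<n. c i (F i)) = (\<Prod>i\<in>{1..<n}. w (F i))"
      by (rule prod.mono_neutral_cong_right) (auto simp: c_def)
    also have "\<dots> = (\<Prod>e\<in>F ` {1..<n}. w e)"
      using inj by (simp add: prod.reindex)
    finally show "(\<Prod>i<n. c i (F i)) = (\<Prod>e\<in>F ` {1..<n}. w e)" .
  qed
  also have "\<dots> = (\<Sum>T\<in>spanning_trees n A. \<Prod>e\<in>T. w e)"
    by (rule sum.reindex_bij_betw[OF bij_betw_rooted_spanning_trees])
  also have "\<dots> = (\<Sum>T\<in>spanning_trees n A. \<Prod>i<n. r i ^ tree_deg T i)"
    unfolding w_def
    by (intro sum.cong prod_edges_tree_deg) (auto simp: spanning_trees_def spanning_tree_def)
  finally show ?thesis .
qed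

section \<open>The critical group of an arithmetical structure\<close>

lemma Gcd_image_bezout:
  fixes r :: "nat \<Rightarrow> int"
  shows "\<exists>u. (\<Sum>i<n. r i * u i) = Gcd (r ` {..<n})"
proof (induction n)
  case 0
  then show ?case by simp
next
  case (Suc n)
  then obtain u where u: "(\<Sum>i<n. r i * u i) = Gcd (r ` {..<n})" by blast
  obtain a b where ab: "a * r n + b * Gcd (r ` {..<n}) = gcd (r n) (Gcd (r ` {..<n}))"
    using bezout_int by blast
  define v where "v i = (if i = n then a else b * u i)" for i
  have "(\<Sum>i<n. r i * v i) = b * (\<Sum>i<n. r i * u i)"
    unfolding sum_distrib_left by (intro sum.cong) (auto simp: v_def)
  then have "(\<Sum>i<Suc n. r i * v i) = Gcd (r ` {..<Suc n})"
    using u ab by (simp add: v_def lessThan_Suc algebra_simps)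
  then show ?case by blast
qed

text \<open>The gcd condition enters through a fixed Bezout vector \<open>u\<close>, from which the
  corrected matrix \<open>M\<close> is formed.\<close>

locale arithmetical_graph =
  fixes n :: nat and A :: "nat \<Rightarrow> nat \<Rightarrow> nat" and r d u :: "nat \<Rightarrow> int"
  assumes n: "0 < n" and G: "loopless_multigraph n A"
    and con: "connected_on n (edges n A)"
    and r_pos: "\<And>i. i < n \<Longrightarrow> 0 < r i"
    and dr: "\<And>i. i < n \<Longrightarrow> d i * r i = (\<Sum>j<n. int (A i j) * r j)"
    and u: "(\<Sum>i<n. r i * u i) = 1" "u \<in> zvecs n"
begin

abbreviation "L \<equiv> Lmat A d"

definition M :: "nat \<Rightarrow> nat \<Rightarrow> int" where
  "M i j = L i j + u i * u j"

section \<open>Action of the matrices on the vector r\<close>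

lemma L_sym: "i < n \<Longrightarrow> j < n \<Longrightarrow> L i j = L j i"
  using G by (auto simp: Lmat_def loopless_multigraph_def)

lemma L_r: "i < n \<Longrightarrow> (\<Sum>j<n. L i j * r j) = 0"
proof -
  assume i: "i < n"
  have "(\<Sum>j<n. L i j * r j) = (\<Sum>j<n. (if j = i then d i * r i else 0) - int (A i j) * r j)"
    by (intro sum.cong) (auto simp: Lmat_def algebra_simps)
  also have "\<dots> = 0" using i by (simp add: sum_subtractf dr)
  finally show ?thesis .
qed

lemma M_r: "i < n \<Longrightarrow> (\<Sum>j<n. M i j * r j) = u i"
proof -
  assume i: "i < n"
  have "(\<Sum>j<n. M i j * r j) = (\<Sum>j<n. L i j * r j) + u i * (\<Sum>j<n. r j * u j)"
    by (simp add: M_def sum_distrib_left algebra_simps sum.distrib)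
  then show ?thesis using i L_r u by simp
qed

lemma M_sym: "i < n \<Longrightarrow> j < n \<Longrightarrow> M i j = M j i"
  by (simp add: M_def L_sym)

lemma r_M: "j < n \<Longrightarrow> (\<Sum>i<n. r i * M i j) = u j"
  using M_r[of j] M_sym[of _ j] by (simp add: mult.commute)

lemma r_L_zero: "(\<Sum>i<n. r i * (\<Sum>j<n. L i j * y j)) = 0"
proof -
  have "(\<Sum>i<n. r i * (\<Sum>j<n. L i j * y j)) = (\<Sum>j<n. \<Sum>i<n. y j * (L j i * r i))"
    unfolding sum_distrib_left
    by (subst sum.swap) (auto intro!: sum.cong simp: L_sym mult_ac)
  also have "\<dots> = 0"
    by (simp add: L_r sum_distrib_left[symmetric])
  finally show ?thesis .
qed

text \<open>With \<open>P\<close> as \<open>diag(r)\<close> whose row 0 is replaced by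
  \<open>r\<close>, the product P M P^T equals Q B for the padded Laplacian B = \<open>?B\<close>.
  Its row 0 is 1 followed by the \<open>r j * u j\<close>, because \<open>M\<close> sends
  \<open>r\<close> to \<open>u\<close> and \<open>r\<close> pairs with \<open>u\<close> to
  1.\<close>

lemma det_M:
  "(\<Prod>i<n. r i)\<^sup>2 * det (sqmat n M) = (\<Sum>T\<in>spanning_trees n A. \<Prod>i<n. r i ^ tree_deg T i)"
proof -
  define P where "P i j = (if i = 0 then r j else if i = j then r i else 0)" for i j
  \<comment> \<open>\<open>Q\<close> adds \<open>r i * u i\<close> times row 0 to row
    \<open>i\<close>; this restores the contribution of the rank-one term \<open>u i * u j\<close>
    of \<open>M\<close>.\<close>
  define Q where "Q i j = (if i = j then 1 else if j = 0 then r i * u i else 0)" for i j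
  define N where "N i j = (if i = 0 then u j else r i * M i j)" for i j
  let ?B = "reduced_laplacian (\<lambda>j. r j * u j) A r d"
  have detP: "det (sqmat n P) = (\<Prod>i<n. r i)"
  proof -
    have "det (sqmat n P) = (\<Prod>i<n. P i i)"
      by (rule det_sqmat_upper_triangular) (auto simp: P_def)
    also have "\<dots> = (\<Prod>i<n. r i)" by (intro prod.cong) (auto simp: P_def)
    finally show ?thesis .
  qed
  have detQ: "det (sqmat n Q) = 1"
    by (subst det_sqmat_transpose[symmetric], subst det_sqmat_upper_triangular) (auto simp: Q_def)
  have PM: "(\<Sum>k<n. P i k * M k j) = N i j" if "i < n" "j < n" for i j
  proof (cases "i = 0")
    case False
    then have "(\<Sum>k<n. P i k * M k j) = (\<Sum>k<n. if k = i then r i * M i j else 0)"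
      by (intro sum.cong) (auto simp: P_def)
    then show ?thesis using False that by (simp add: N_def)
  qed (use that r_M in \<open>simp add: P_def N_def\<close>)
  have NP: "(\<Sum>k<n. N i k * P j k) = (\<Sum>k<n. Q i k * ?B k j)" if ij: "i < n" "j < n" for i j
  proof -
    have Q: "(\<Sum>k<n. Q i k * ?B k j) = (if i = 0 then ?B 0 j else r i * u i * ?B 0 j + ?B i j)"
    proof -
      have "(\<Sum>k<n. Q i k * ?B k j) = (\<Sum>k<n. (if k = i then ?B i j else 0) +
          (if k = 0 then if i = 0 then 0 else r i * u i * ?B 0 j else 0))"
        by (intro sum.cong) (auto simp: Q_def)
      then show ?thesis using ij n by (simp add: sum.distrib)
    qed
    have "(\<Sum>k<n. N i k * P j k) = (if j = 0 then if i = 0 then 1 else r i * u i else N i j * r j)"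
    proof (cases "j = 0")
      case True
      have "(\<Sum>k<n. r i * M i k * r k) = r i * u i"
        using M_r[OF ij(1)] by (simp add: mult.assoc flip: sum_distrib_left)
      then show ?thesis using True u(1) by (simp add: P_def N_def mult.commute)
    next
      case False
      then have "(\<Sum>k<n. N i k * P j k) = (\<Sum>k<n. if k = j then N i j * r j else 0)"
        by (intro sum.cong) (auto simp: P_def)
      then show ?thesis using False ij by simp
    qed
    then show ?thesis
      unfolding Q by (auto simp: N_def M_def reduced_laplacian_def algebra_simps)
  qed
  have "sqmat n (\<lambda>i j. \<Sum>k<n. P i k * M k j) = sqmat n N"
    by (intro eq_matI) (auto simp: PM)
  from arg_cong[OF this, of det] have "det (sqmat n P) * det (sqmat n M) = det (sqmat n N)"
    by (simp only: det_sqmat_mult)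
  moreover have "sqmat n (\<lambda>i j. \<Sum>k<n. N i k * P j k) = sqmat n (\<lambda>i j. \<Sum>k<n. Q i k * ?B k j)"
    by (intro eq_matI) (auto simp: NP)
  from arg_cong[OF this, of det]
  have "det (sqmat n N) * det (sqmat n (\<lambda>i j. P j i)) = det (sqmat n Q) * det (sqmat n ?B)"
    using det_sqmat_mult[of n N "\<lambda>i j. P j i"] det_sqmat_mult[of n Q ?B] by simp
  ultimately show ?thesis
    using weighted_matrix_tree[OF G dr, of "\<lambda>j. r j * u j"] det_sqmat_transpose[of n P]
    by (simp add: detP detQ power2_eq_square mult_ac)
qed

text \<open>Connectedness provides a spanning tree, and every tree contributes a positive
  product.\<close>

lemma det_M_pos: "0 < det (sqmat n M)"
proof -
  have "finite (spanning_trees n A)"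
    by (rule finite_subset[of _ "Pow (edges n A)"]) (auto simp: spanning_trees_def spanning_tree_def)
  moreover have "spanning_trees n A \<noteq> {}"
  proof -
    obtain F where "F \<in> orientations n (edges n A)" "rooted n F"
      using rooted_orientation_exists[OF subset_refl con] .
    then show ?thesis using bij_betw_rooted_spanning_trees[of n A] by (auto simp: bij_betw_def)
  qed
  ultimately have "0 < (\<Sum>T\<in>spanning_trees n A. \<Prod>i<n. r i ^ tree_deg T i)"
    using r_pos by (intro sum_pos prod_pos) auto
  then have "0 < (\<Prod>i<n. r i)\<^sup>2 * det (sqmat n M)" by (simp add: det_M)
  then show ?thesis by (simp add: zero_less_mult_iff)
qed

section \<open>Comparison of the lattices of L and M, and the torsion group\<close>

lemma in_lattice_M_u: "in_lattice n M u"
  unfolding in_lattice_def using M_r by (intro exI[of _ r]) simp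

lemma M_apply: "(\<Sum>j<n. M i j * y j) = (\<Sum>j<n. L i j * y j) + (\<Sum>j<n. u j * y j) * u i"
  by (simp add: M_def algebra_simps sum.distrib sum_distrib_left)

text \<open>Since M y = L y + (u.y) u and \<open>u\<close> lies in the lattice of \<open>M\<close>,
  the lattice of \<open>L\<close> is contained in it. Pairing M y with \<open>r\<close> gives u.y,
  so orthogonality to \<open>r\<close> removes the correction and leaves L y.\<close>

lemma in_lattice_L_iff: "in_lattice n L x \<longleftrightarrow> in_lattice n M x \<and> (\<Sum>i<n. r i * x i) = 0"
proof
  assume "in_lattice n L x"
  then obtain y where y: "\<And>i. i < n \<Longrightarrow> x i = (\<Sum>j<n. L i j * y j)"
    unfolding in_lattice_def by blast
  define c where "c = (\<Sum>j<n. u j * y j)"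
  have "in_lattice n M (\<lambda>i. (\<Sum>j<n. M i j * y j) - c * u i)"
    by (intro in_lattice_diff in_lattice_scale in_lattice_M_u) (auto simp: in_lattice_def)
  also have "?this \<longleftrightarrow> in_lattice n M x"
    by (rule in_lattice_cong) (simp add: M_apply y c_def)
  finally show "in_lattice n M x \<and> (\<Sum>i<n. r i * x i) = 0"
    using r_L_zero[of y] by (simp add: y)
next
  assume x: "in_lattice n M x \<and> (\<Sum>i<n. r i * x i) = 0"
  then obtain y where y: "\<And>i. i < n \<Longrightarrow> x i = (\<Sum>j<n. M i j * y j)"
    unfolding in_lattice_def by blast
  define c where "c = (\<Sum>j<n. u j * y j)"
  have "(\<Sum>i<n. r i * x i) = (\<Sum>i<n. r i * (\<Sum>j<n. L i j * y j) + c * (r i * u i))"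
    by (intro sum.cong) (simp_all add: y M_apply distrib_left flip: c_def)
  also have "\<dots> = (\<Sum>i<n. r i * (\<Sum>j<n. L i j * y j)) + c * (\<Sum>i<n. r i * u i)"
    by (simp only: sum.distrib sum_distrib_left[of c])
  finally have "(\<Sum>i<n. r i * x i) = (\<Sum>i<n. r i * (\<Sum>j<n. L i j * y j)) + c * (\<Sum>i<n. r i * u i)" .
  then have "c = 0" using x r_L_zero u(1) by simp
  then show "in_lattice n L x"
    unfolding in_lattice_def using y by (auto simp: M_apply c_def)
qed

text \<open>The image of \<open>L\<close> is orthogonal to \<open>r\<close>, and a positive
  multiplier can be cancelled from the pairing; conversely \<open>det (sqmat n M)\<close> is a
  multiplier for every vector orthogonal to \<open>r\<close>.\<close>

lemma torsion_iff:
  assumes x: "x \<in> zvecs n"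
  shows "(\<exists>m>0. (\<lambda>i. m * x i) \<in> image_lattice n L) \<longleftrightarrow> (\<Sum>i<n. r i * x i) = 0"
proof -
  have zv: "(\<lambda>i. m * x i) \<in> zvecs n" for m using x by (simp add: zvecs_def)
  have sum: "(\<Sum>i<n. r i * (m * x i)) = m * (\<Sum>i<n. r i * x i)" for m
    by (simp add: sum_distrib_left mult_ac)
  show ?thesis
  proof
    assume "\<exists>m>0. (\<lambda>i. m * x i) \<in> image_lattice n L"
    then obtain m where "m > 0" "in_lattice n L (\<lambda>i. m * x i)"
      by (auto simp: image_lattice_iff[OF zv])
    then show "(\<Sum>i<n. r i * x i) = 0" by (simp add: in_lattice_L_iff sum)
  next
    assume "(\<Sum>i<n. r i * x i) = 0"
    then have "in_lattice n L (\<lambda>i. det (sqmat n M) * x i)"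
      by (simp add: in_lattice_L_iff sum in_lattice_det_scale)
    then show "\<exists>m>0. (\<lambda>i. m * x i) \<in> image_lattice n L"
      using det_M_pos by (auto simp: image_lattice_iff[OF zv])
  qed
qed

text \<open>A transversal of the lattice of \<open>M\<close> is projected along \<open>u\<close> to
  the vectors orthogonal to \<open>r\<close>. As \<open>u\<close> lies in that lattice, classes
  modulo \<open>M\<close> are kept, and between vectors orthogonal to \<open>r\<close> congruence
  modulo \<open>M\<close> and modulo \<open>L\<close> agree.\<close>

lemma crit_group_order_eq_det: "crit_group_order n A d = nat (det (sqmat n M))"
proof -
  define X where "X = {x \<in> zvecs n. (\<Sum>i<n. r i * x i) = 0}"
  define R where "R = {(x, y). x \<in> zvecs n \<and> y \<in> zvecs n \<and> (\<lambda>i. x i - y i) \<in> image_lattice n L}"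
  have R: "(x, y) \<in> R \<longleftrightarrow> x \<in> zvecs n \<and> y \<in> zvecs n \<and> in_lattice n L (\<lambda>i. x i - y i)" for x y
  proof -
    have "(\<lambda>i. x i - y i) \<in> zvecs n" if "x \<in> zvecs n" "y \<in> zvecs n"
      using that by (simp add: zvecs_def)
    then show ?thesis by (auto simp: R_def image_lattice_iff)
  qed
  have "equiv (zvecs n) R"
  proof (intro equivI refl_onI symI transI)
    show "(y, x) \<in> R" if "(x, y) \<in> R" for x y
      using that in_lattice_scale[of n L "\<lambda>i. x i - y i" "-1"] by (simp add: R)
    show "(x, z) \<in> R" if "(x, y) \<in> R" "(y, z) \<in> R" for x y z
      using that in_lattice_add[of n L "\<lambda>i. x i - y i" "\<lambda>i. y i - z i"] by (simp add: R)
  qed (auto simp: R in_lattice_zero)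
  obtain S where S: "S \<subseteq> zvecs n" "finite S" "card S = nat (det (sqmat n M))"
    "\<And>x. \<exists>!s. s \<in> S \<and> in_lattice n M (\<lambda>i. x i - s i)"
    using has_index_det[of n M] det_M_pos unfolding has_index_def by auto
  \<comment> \<open>The projection along \<open>u\<close>: subtracting the pairing with
    \<open>r\<close> times \<open>u\<close> gives a vector orthogonal to \<open>r\<close>, because
    \<open>r\<close> pairs with \<open>u\<close> to 1.\<close>
  define h where "h s = (\<lambda>i. s i - (\<Sum>k<n. r k * s k) * u i)" for s
  have hX: "h s \<in> X" if "s \<in> zvecs n" for s
  proof -
    have "(\<Sum>i<n. r i * h s i) = (\<Sum>i<n. r i * s i) - (\<Sum>k<n. r k * s k) * (\<Sum>i<n. r i * u i)"
      by (simp add: h_def right_diff_distrib sum_subtractf sum_distrib_left mult_ac)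
    then show ?thesis using that u by (simp add: X_def) (simp add: h_def zvecs_def)
  qed
  have h_lat: "in_lattice n M (\<lambda>i. s i - h s i)" for s
    unfolding h_def using in_lattice_scale[OF in_lattice_M_u] by simp
  have "bij_betw (\<lambda>s. R `` {h s}) S (X // R)"
  proof (rule bij_betw_imageI)
    show "inj_on (\<lambda>s. R `` {h s}) S"
    proof (rule inj_onI)
      fix s t assume st: "s \<in> S" "t \<in> S" "R `` {h s} = R `` {h t}"
      then have "h s \<in> zvecs n" "h t \<in> zvecs n" using hX S(1) by (auto simp: X_def)
      then have "(h s, h t) \<in> R"
        using eq_equiv_class[OF st(3) \<open>equiv (zvecs n) R\<close>] by blast
      then have "in_lattice n M (\<lambda>i. h s i - h t i)" by (simp add: R in_lattice_L_iff)
      from in_lattice_diff[OF in_lattice_add[OF this h_lat[of s]] h_lat[of t]]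
      have "in_lattice n M (\<lambda>i. s i - t i)" by (simp add: algebra_simps)
      moreover have "in_lattice n M (\<lambda>i. s i - s i)" by (simp add: in_lattice_zero)
      ultimately show "s = t" using S(4)[of s] st by blast
    qed
    have "C \<in> (\<lambda>s. R `` {h s}) ` S" if C: "C \<in> X // R" for C
    proof -
      from C obtain x where x: "x \<in> X" "C = R `` {x}" by (auto elim: quotientE)
      obtain s where s: "s \<in> S" "in_lattice n M (\<lambda>i. x i - s i)" using S(4)[of x] by blast
      have hs: "h s \<in> X" using hX S(1) s(1) by blast
      have "in_lattice n M (\<lambda>i. x i - h s i)"
        using in_lattice_add[OF s(2) h_lat[of s]] by simp
      moreover have "(\<Sum>i<n. r i * (x i - h s i)) = 0"
        using x(1) hs by (simp add: X_def right_diff_distrib sum_subtractf)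
      ultimately have "(x, h s) \<in> R" using x(1) hs by (simp add: R in_lattice_L_iff X_def)
      then have "C = R `` {h s}" using equiv_class_eq[OF \<open>equiv (zvecs n) R\<close>] x(2) by blast
      then show ?thesis using s(1) by blast
    qed
    moreover have "R `` {h s} \<in> X // R" if "s \<in> S" for s
      using hX S(1) that by (blast intro: quotientI)
    ultimately show "(\<lambda>s. R `` {h s}) ` S = X // R" by blast
  qed
  then have "card S = card (X // R)" by (rule bij_betw_same_card)
  moreover have "torsion_coker n L = X // R"
  proof -
    have "{x \<in> zvecs n. \<exists>m>0. (\<lambda>i. m * x i) \<in> image_lattice n L} = X"
      unfolding X_def using torsion_iff by blast
    then show ?thesis unfolding torsion_coker_def R_def by simp
  qed
  ultimately show ?thesis by (simp add: crit_group_order_def S(3))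
qed

end

theorem mainTheorem12:
  fixes n :: nat and A :: "nat \<Rightarrow> nat \<Rightarrow> nat" and r d :: "nat \<Rightarrow> int"
  assumes "n \<ge> 1"
    and "loopless_multigraph n A"
    and "connected_on n (edges n A)"
    and "arith_structure n A r d"
  shows "real (crit_group_order n A d) =
    (\<Sum>T\<in>spanning_trees n A. \<Prod>i<n. (real_of_int (r i)) powi (int (tree_deg T i) - 2))"
proof -
  obtain u where u: "(\<Sum>i<n. r i * u i) = 1"
    using Gcd_image_bezout[of r n] assms(4) by (auto simp: arith_structure_def)
  \<comment> \<open>Bezout coefficients are arbitrary from \<open>n\<close> on, so they are cut off
    to lie in \<open>zvecs n\<close>.\<close>
  interpret arithmetical_graph n A r d "\<lambda>i. if i < n then u i else 0"
    by unfold_locales (use assms u in \<open>auto simp: arith_structure_def zvecs_def\<close>)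
  have pos: "real_of_int (r i) \<noteq> 0" if "i < n" for i using r_pos[OF that] by simp
  let ?p = "\<Prod>i<n. real_of_int (r i)"
  have "?p \<noteq> 0" using pos by simp
  \<comment> \<open>Multiplying by the square of the product of the \<open>r i\<close> turns the
    exponents \<open>tree_deg T i - 2\<close>, which may be negative, into natural powers.\<close>
  have "?p\<^sup>2 * real (crit_group_order n A d) = ?p\<^sup>2 * real_of_int (det (sqmat n M))"
    using det_M_pos by (simp add: crit_group_order_eq_det)
  also have "\<dots> = real_of_int ((\<Prod>i<n. r i)\<^sup>2 * det (sqmat n M))" by simp
  also have "\<dots> = (\<Sum>T\<in>spanning_trees n A. \<Prod>i<n. real_of_int (r i) ^ tree_deg T i)"
    by (simp add: det_M)
  also have "\<dots> = ?p\<^sup>2 *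
      (\<Sum>T\<in>spanning_trees n A. \<Prod>i<n. (real_of_int (r i)) powi (int (tree_deg T i) - 2))"
    unfolding sum_distrib_left prod_power_distrib prod.distrib[symmetric]
    by (intro sum.cong prod.cong) (use pos in \<open>auto simp: power_int_diff\<close>)
  finally show ?thesis using \<open>?p \<noteq> 0\<close> by simp
qed

end
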